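(* Let $Q$ be a level two even positive-definite quadratic form in $v$ variables. If $8\mid v$, then $Q$ represents a positive integer $2n$ with $2n\le 2+\frac v4$. If $v\equiv 4\pmod 8$, then $Q$ represents a positive integer $2n$ with $2n\le 2+\frac v2$.
   Context: Let $v$ be a positive even integer and let $A$ be a $v\times v$ symmetric matrix with integer entries, even diagonal entries and positive eigenvalues. The even positive-definite quadratic form associated to $A$ is $Q_A(\mathbf x)={}^t\mathbf x A\mathbf x$ (with no factor $\tfrac12$), for column vectors $\mathbf x={}^t(x_1,\dots,x_v)$; it takes even values on $\mathbf Z^v$. The level of $Q_A$ is the smallest positive integer $N$ such that $NA^{-1}$ also has integer entries and even diagonal entries. $Q_A$ represents an integer $m$ if $Q_A(\mathbf x)=m$ for some $\mathbf x\in\mathbf Z^v$. In the claim $n$ is an integer. *)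

theory Defs
  imports "HOL-Analysis.Analysis"
begin

definition even_integral :: "real^'n^'n \<Rightarrow> bool" where
  "even_integral M \<longleftrightarrow> (\<forall>i j. M $ i $ j \<in> \<int>) \<and> (\<forall>i. \<exists>k::int. M $ i $ i = 2 * of_int k)"

definition eigenvalue :: "real^'n^'n \<Rightarrow> real \<Rightarrow> bool" where
  "eigenvalue M c \<longleftrightarrow> (\<exists>x. x \<noteq> 0 \<and> M *v x = c *s x)"

text \<open>Real eigenvalues suffice: all complex eigenvalues of a real symmetric matrix are real.\<close>

definition even_pos_def :: "real^'n^'n \<Rightarrow> bool" where
  "even_pos_def A \<longleftrightarrow>
     transpose A = A \<and> even_integral A \<and> (\<forall>c. eigenvalue A c \<longrightarrow> c > 0)"

text \<open>The normalisation carries no factor 1/2, so an even matrix gives even values at integer vectors.\<close>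

definition quad_form :: "real^'n^'n \<Rightarrow> real^'n \<Rightarrow> real" where
  "quad_form A x = x \<bullet> (A *v x)"

text \<open>
  For an even positive-definite \<open>A\<close> the minimum exists and \<open>matrix_inv A\<close> is the true inverse:
  \<open>A\<close> is invertible, and \<open>N = 2 * det A\<close> is a positive integer with the required property.
\<close>

definition level :: "real^'n^'n \<Rightarrow> nat" where
  "level A = (LEAST N. N > 0 \<and> even_integral (real N *\<^sub>R matrix_inv A))"

definition represents :: "(real^'n \<Rightarrow> real) \<Rightarrow> int \<Rightarrow> bool" where
  "represents Q m \<longleftrightarrow> (\<exists>x. (\<forall>i. x $ i \<in> \<int>) \<and> Q x = of_int m)"

end

theory Submission
  imports Defs
begin

text \<open>
  Theorems of this kind are usually proved with modular forms. The argument here is instead a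
  density estimate from the geometry of numbers. Write \<open>v = 2 h\<close> for the number of variables.

  Level two means that \<open>2 A\<^sup>-\<^sup>1\<close> is an integer matrix. Its determinant \<open>2\<^sup>v / det A\<close> is a positive integer,
  so \<open>det A \<le> 2\<^sup>v\<close>: the lattice with Gram matrix \<open>A\<close> is not too sparse, and hence it has a short vector.
  Quantitatively, if all nonzero integer vectors satisfy \<open>quad_form A z \<ge> m\<close>, then Blichfeldt's bound
  (lemma \<open>blichfeldt_bound\<close>) says \<open>(\<pi> m / 2)\<^sup>h \<le> (h + 1)! sqrt (det A)\<close>, and the right side is at most
  \<open>(h + 1)! 2\<^sup>h\<close>. For \<open>m = 4 + v / 4\<close> this contradicts the elementary inequality
  \<open>(h + 1)! < (\<pi> (h + 8) / 8)\<^sup>h\<close> of lemma \<open>fact_less_power\<close>. So some nonzero integer vector has a value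
  strictly below \<open>4 + v / 4\<close>. The values of the form are even integers. If \<open>8\<close> divides \<open>v\<close>, then
  \<open>4 + v / 4\<close> is an even integer and the value is at most \<open>2 + v / 4\<close>. If \<open>v\<close> is \<open>4\<close> modulo \<open>8\<close>, then the
  value is at most \<open>3 + v / 4\<close>, which is at most \<open>2 + v / 2\<close>.

  Blichfeldt's bound is used rather than Minkowski's: for \<open>det A = 2\<^sup>v\<close> the latter only bounds the
  minimum by about \<open>4 v / (\<pi> e)\<close>, which is nearly \<open>v / 2\<close>, whereas the former gives half of that,
  just below \<open>v / 4\<close>. The bound needs a factorization \<open>A = transpose B ** B\<close>, which turns the values of the
  form into squared Euclidean lengths (lemma \<open>pos_def_matrix_factorization\<close>).
\<close>

section \<open>Overlapping weights around separated points\<close>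

text \<open>
  This is the heart of Blichfeldt's bound. If a point \<open>x\<close> receives positive weight from \<open>k\<close> centres,
  with displacements \<open>p i\<close>, then averaging over all pairs of centres gives
  \<open>k (k - 1) m \<le> (\<Sum>i j. \<bar>p i - p j\<bar>\<^sup>2) = 2 k (\<Sum>i. \<bar>p i\<bar>\<^sup>2) - 2 \<bar>\<Sum>i. p i\<bar>\<^sup>2 \<le> 2 k (\<Sum>i. \<bar>p i\<bar>\<^sup>2)\<close>,
  and this says that the weights add up to at most 1. The weights are supported on balls of squared
  radius \<open>m / 2\<close>, which may overlap; disjoint balls would only allow the squared radius \<open>m / 4\<close>.
\<close>

lemma sum_packing_weights_le_1:
  fixes p :: "'i \<Rightarrow> 'a::real_inner" and m :: real
  assumes "finite T" and m: "m > 0"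
    and sep: "\<And>i j. i \<in> T \<Longrightarrow> j \<in> T \<Longrightarrow> i \<noteq> j \<Longrightarrow> m \<le> (norm (p i - p j))\<^sup>2"
  shows "(\<Sum>i\<in>T. max 0 (1 - 2 * (norm (p i))\<^sup>2 / m)) \<le> 1"
proof -
  \<comment> \<open>The centres with positive weight. Only for them does dropping the maximum with 0 cost nothing.\<close>
  define S where "S = {i \<in> T. 2 * (norm (p i))\<^sup>2 < m}"
  have S: "finite S" "S \<subseteq> T" using assms(1) by (auto simp: S_def)
  define q where "q = (\<Sum>i\<in>S. (norm (p i))\<^sup>2)"
  define k where "k = real (card S)"
  have "(\<Sum>i\<in>T. max 0 (1 - 2 * (norm (p i))\<^sup>2 / m)) = (\<Sum>i\<in>S. max 0 (1 - 2 * (norm (p i))\<^sup>2 / m))"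
  proof (rule sum.mono_neutral_right)
    show "\<forall>i\<in>T - S. max 0 (1 - 2 * (norm (p i))\<^sup>2 / m) = 0"
    proof
      fix i assume "i \<in> T - S"
      then have "1 \<le> 2 * (norm (p i))\<^sup>2 / m" using m by (auto simp: S_def not_less)
      then show "max 0 (1 - 2 * (norm (p i))\<^sup>2 / m) = 0" by simp
    qed
  qed (use S assms(1) in auto)
  also have "\<dots> = (\<Sum>i\<in>S. 1 - 2 * (norm (p i))\<^sup>2 / m)"
    using m by (intro sum.cong) (auto simp: S_def field_simps)
  also have "\<dots> = k - 2 * q / m"
    by (simp add: sum_subtractf k_def q_def sum_distrib_left sum_divide_distrib)
  also have "\<dots> \<le> 1"
  proof (cases "S = {}")
    case True
    then show ?thesis by (simp add: k_def q_def)
  next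
    case False
    then have k: "k > 0" using S by (simp add: k_def card_gt_0_iff)
    have "k * (k - 1) * m = (\<Sum>i\<in>S. \<Sum>j\<in>S. if i = j then 0 else m)"
    proof -
      have "(\<Sum>j\<in>S. if i = j then 0 else m) = (k - 1) * m" if "i \<in> S" for i
      proof -
        have "(\<Sum>j\<in>S. if i = j then 0 else m) = (\<Sum>j\<in>S. m - (if i = j then m else 0))"
          by (intro sum.cong) auto
        also have "\<dots> = (k - 1) * m"
          using S that by (simp add: sum_subtractf k_def algebra_simps)
        finally show ?thesis .
      qed
      then show ?thesis by (simp add: k_def)
    qed
    also have "\<dots> \<le> (\<Sum>i\<in>S. \<Sum>j\<in>S. (norm (p i - p j))\<^sup>2)"
      using sep S by (intro sum_mono) auto
    also have "\<dots> = (\<Sum>i\<in>S. \<Sum>j\<in>S. (norm (p i))\<^sup>2 + (norm (p j))\<^sup>2 - 2 * (p i \<bullet> p j))"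
      by (simp add: power2_norm_eq_inner inner_diff inner_commute algebra_simps)
    also have "\<dots> = 2 * k * q - 2 * (norm (\<Sum>i\<in>S. p i))\<^sup>2"
    proof -
      have "(norm (\<Sum>i\<in>S. p i))\<^sup>2 = (\<Sum>i\<in>S. \<Sum>j\<in>S. p i \<bullet> p j)"
        unfolding power2_norm_eq_inner inner_sum_left by (simp add: inner_sum_right)
      then show ?thesis
        by (simp add: sum.distrib sum_subtractf q_def k_def sum_distrib_left mult.assoc)
    qed
    also have "\<dots> \<le> 2 * k * q" by simp
    finally have "k * ((k - 1) * m) \<le> k * (2 * q)" by (simp add: algebra_simps)
    then have "(k - 1) * m \<le> 2 * q" using k by simp
    then show ?thesis using m by (simp add: field_simps)
  qed
  finally show ?thesis .
qed

section \<open>Integrals and lattice sums\<close>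

text \<open>
  Cut space into the integer translates of the half-open unit cube, move each piece of the integral
  back to the cube, and exchange sum and integral: the integral of \<open>f\<close> over the whole space becomes
  the integral over a cube of volume 1 of the lattice sum of \<open>f\<close>.
\<close>

lemma nn_integral_le_1_if_lattice_sums_le_1:
  fixes f :: "real^'n \<Rightarrow> ennreal"
  assumes f [measurable]: "f \<in> borel_measurable borel"
    and le1: "\<And>x Z. finite Z \<Longrightarrow> Z \<subseteq> {z. \<forall>i. z $ i \<in> \<int>} \<Longrightarrow> (\<Sum>z\<in>Z. f (x + z)) \<le> 1"
  shows "(\<integral>\<^sup>+x. f x \<partial>lborel) \<le> 1"
proof -
  define L :: "(real^'n) set" where "L = {z. \<forall>i. z $ i \<in> \<int>}"
  \<comment> \<open>The lattice is countably infinite, hence enumerated without repetition by some e.\<close>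
  have "L \<subseteq> range (\<lambda>z::int^'n. \<chi> i. real_of_int (z $ i))"
  proof
    fix z :: "real^'n" assume "z \<in> L"
    then have "z = (\<chi> i. real_of_int ((\<chi> i. \<lfloor>z $ i\<rfloor>) $ i))"
      by (auto simp: L_def vec_eq_iff elim: Ints_cases)
    then show "z \<in> range (\<lambda>z::int^'n. \<chi> i. real_of_int (z $ i))" by blast
  qed
  then have "countable L" by (rule countable_subset) simp
  have "inj (\<lambda>k::nat. (\<chi> i. real k) :: real^'n)"
    by (auto simp: inj_def vec_eq_iff)
  moreover have "range (\<lambda>k::nat. (\<chi> i. real k) :: real^'n) \<subseteq> L" by (auto simp: L_def)
  ultimately have "infinite L" by (metis finite_subset range_inj_infinite)
  define e where "e = from_nat_into L"
  have e: "bij_betw e UNIV L"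
    unfolding e_def by (intro bij_betw_from_nat_into) fact+
  have eL: "e k \<in> L" for k using e by (auto simp: bij_betw_def)
  have e_int: "\<exists>a. e k $ i = real_of_int a" for k i
    using eL[of k] by (auto simp: L_def Ints_def)
  \<comment> \<open>K z is the half-open unit cube with lowest corner z, for a lattice point z.\<close>
  define K :: "real^'n \<Rightarrow> (real^'n) set" where "K = (\<lambda>z. {x. \<forall>i. real_of_int \<lfloor>x $ i\<rfloor> = z $ i})"
  have K [measurable]: "K z \<in> sets borel" for z
    unfolding K_def by measurable
  have disj: "disjoint_family (\<lambda>k. K (e k))"
  proof -
    have "e k = e l" if "x \<in> K (e k)" "x \<in> K (e l)" for k l x
      using that by (simp add: K_def vec_eq_iff)
    then show ?thesis using e unfolding disjoint_family_on_def bij_betw_def inj_def by blast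
  qed
  have cover: "\<exists>k. x \<in> K (e k)" for x
  proof -
    have "(\<chi> i. real_of_int \<lfloor>x $ i\<rfloor>) \<in> L" by (simp add: L_def)
    then obtain k where "e k = (\<chi> i. real_of_int \<lfloor>x $ i\<rfloor>)"
      using e unfolding bij_betw_def by (metis imageE)
    then have "x \<in> K (e k)" by (simp add: K_def)
    then show ?thesis ..
  qed
  have "(\<integral>\<^sup>+x. f x \<partial>lborel) = (\<integral>\<^sup>+x. (\<Sum>k. f x * indicator (K (e k)) x) \<partial>lborel)"
  proof (rule nn_integral_cong)
    fix x :: "real^'n"
    obtain k where "x \<in> K (e k)" using cover by blast
    from suminf_cmult_indicator[OF disj this, of "\<lambda>_. f x"]
    show "f x = (\<Sum>k. f x * indicator (K (e k)) x)" by simp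
  qed
  also have "\<dots> = (\<Sum>k. \<integral>\<^sup>+x. f x * indicator (K (e k)) x \<partial>lborel)"
    by (rule nn_integral_suminf) simp
  also have "\<dots> = (\<Sum>k. \<integral>\<^sup>+x. f (x + e k) * indicator (K 0) x \<partial>lborel)"
  proof (rule suminf_cong)
    fix k
    have "(\<integral>\<^sup>+x. f x * indicator (K (e k)) x \<partial>lborel)
        = (\<integral>\<^sup>+x. f x * indicator (K (e k)) x \<partial>distr lborel borel ((+) (e k)))"
      by (simp add: lborel_distr_plus)
    also have "\<dots> = (\<integral>\<^sup>+x. f (e k + x) * indicator (K (e k)) (e k + x) \<partial>lborel)"
      by (subst nn_integral_distr) auto
    also have "\<dots> = (\<integral>\<^sup>+x. f (x + e k) * indicator (K 0) x \<partial>lborel)"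
    proof (rule nn_integral_cong)
      fix x :: "real^'n"
      have "real_of_int \<lfloor>e k $ i + x $ i\<rfloor> = e k $ i \<longleftrightarrow> \<lfloor>x $ i\<rfloor> = 0" for i
        using e_int[of k i] by auto
      then have "e k + x \<in> K (e k) \<longleftrightarrow> x \<in> K 0" by (simp add: K_def)
      then show "f (e k + x) * indicator (K (e k)) (e k + x) = f (x + e k) * indicator (K 0) x"
        by (simp add: indicator_def add.commute)
    qed
    finally show "(\<integral>\<^sup>+x. f x * indicator (K (e k)) x \<partial>lborel)
        = (\<integral>\<^sup>+x. f (x + e k) * indicator (K 0) x \<partial>lborel)" .
  qed
  also have "\<dots> = (\<integral>\<^sup>+x. (\<Sum>k. f (x + e k) * indicator (K 0) x) \<partial>lborel)"
    by (rule nn_integral_suminf[symmetric]) simp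
  also have "\<dots> \<le> (\<integral>\<^sup>+x. indicator (K 0) x \<partial>lborel)"
  proof (rule nn_integral_mono)
    fix x :: "real^'n"
    have "(\<Sum>k<N. f (x + e k)) \<le> 1" for N
    proof -
      have "(\<Sum>k<N. f (x + e k)) = (\<Sum>z\<in>e ` {..<N}. f (x + z))"
        using e by (subst sum.reindex) (auto simp: bij_betw_def inj_on_def inj_def)
      also have "\<dots> \<le> 1" using eL by (intro le1) (auto simp: L_def)
      finally show ?thesis .
    qed
    then have "(\<Sum>k. f (x + e k)) \<le> 1" by (intro suminf_le_const) auto
    then show "(\<Sum>k. f (x + e k) * indicator (K 0) x) \<le> indicator (K 0) x"
      by (auto simp: indicator_def)
  qed
  also have "\<dots> = emeasure lborel (K 0)" by simp
  also have "\<dots> \<le> emeasure lborel (cbox 0 1 :: (real^'n) set)"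
  proof (rule emeasure_mono)
    show "K 0 \<subseteq> cbox 0 1"
      by (auto simp: K_def mem_box_cart floor_eq_iff less_imp_le)
  qed simp
  also have "\<dots> = 1"
  proof -
    have "1 \<bullet> b = 1" if "b \<in> Basis" for b :: "real^'n"
      using that by (auto simp: Basis_vec_def inner_axis)
    then show ?thesis by (simp add: emeasure_lborel_cbox_eq)
  qed
  finally show ?thesis .
qed

section \<open>The integral of a quadratic weight\<close>

lemma continuous_on_norm_matrix_vector_mult:
  fixes B :: "real^'n^'m"
  shows "continuous_on S (\<lambda>x. norm (B *v x))"
  by (intro continuous_on_norm linear_continuous_on linear_conv_bounded_linear[THEN iffD1]
      matrix_vector_mul_linear)

text \<open>
  The ellipsoid is the image of a ball under the inverse of \<open>B\<close>. The well-order on the index type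
  comes from the determinant formula for volumes of linear images.
\<close>

lemma emeasure_ellipsoid:
  fixes B :: "real^'n::{finite,wellorder}^'n::{finite,wellorder}"
  assumes "det B \<noteq> 0" and "r \<ge> 0"
  shows "emeasure lborel {x. norm (B *v x) < r} =
    ennreal (unit_ball_vol (real CARD('n)) * r ^ CARD('n) / \<bar>det B\<bar>)"
proof -
  obtain C where C: "B ** C = mat 1" "C ** B = mat 1"
    using assms(1) unfolding invertible_det_nz[symmetric] invertible_def by blast
  have "det B * det C = 1" using C(1) by (metis det_mul det_I)
  then have detC: "\<bar>det C\<bar> = 1 / \<bar>det B\<bar>"
    using assms(1) by (metis abs_mult abs_one nonzero_mult_div_cancel_left abs_eq_0)
  have eq: "{x. norm (B *v x) < r} = (*v) C ` ball 0 r" (is "?E = _")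
  proof (intro equalityI subsetI)
    fix x assume "x \<in> ?E"
    moreover have "x = C *v (B *v x)" by (simp add: matrix_vector_mul_assoc C)
    ultimately show "x \<in> (*v) C ` ball 0 r" by (metis (mono_tags) image_eqI mem_Collect_eq mem_ball_0)
  next
    fix x assume "x \<in> (*v) C ` ball 0 r"
    then show "x \<in> ?E" by (auto simp: matrix_vector_mul_assoc C)
  qed
  have "open ?E"
    by (intro open_Collect_less continuous_on_norm_matrix_vector_mult continuous_on_const)
  then have borel: "?E \<in> sets borel" by simp
  have lm: "ball 0 r \<in> lmeasurable" by simp
  have "?E \<in> lmeasurable"
    unfolding eq by (rule measurable_linear_image[OF matrix_vector_mul_linear lm])
  then have "emeasure lebesgue ?E = ennreal (measure lebesgue ?E)" by (rule emeasure_eq_measure2)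
  moreover have "emeasure lborel ?E = emeasure lebesgue ?E" using borel by simp
  ultimately have "emeasure lborel ?E = ennreal (measure lebesgue ?E)" by simp
  also have "measure lebesgue ?E = \<bar>det C\<bar> * measure lborel (ball (0 :: real^'n::{finite,wellorder}) r)"
    unfolding eq using measure_linear_image[OF matrix_vector_mul_linear lm, of C] by simp
  also have "\<dots> = unit_ball_vol (real CARD('n)) * r ^ CARD('n) / \<bar>det B\<bar>"
    using assms(2) detC by (simp add: content_ball)
  finally show ?thesis .
qed

text \<open>
  By the layer-cake formula the integral is \<open>\<integral>\<^sub>0\<^sup>1 vol {x. \<bar>B x\<bar>\<^sup>2 < (1 - t) m / 2} dt\<close>, and in dimension
  \<open>2 h\<close> the volume inside is \<open>\<pi>\<^sup>h / h!\<close> times \<open>((1 - t) m / 2)\<^sup>h\<close>, divided by \<open>\<bar>det B\<bar>\<close>.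
\<close>

lemma nn_integral_ellipsoid_weight:
  fixes B :: "real^'n::{finite,wellorder}^'n::{finite,wellorder}" and m :: real
  assumes "det B \<noteq> 0" and m: "m > 0" and h: "CARD('n) = 2 * h"
  shows "(\<integral>\<^sup>+x. ennreal (max 0 (1 - 2 * (norm (B *v x))\<^sup>2 / m)) \<partial>lborel) =
    ennreal ((pi * m / 2) ^ h / (fact (h + 1) * \<bar>det B\<bar>))"
proof -
  define u where "u = (\<lambda>x. 2 * (norm (B *v x))\<^sup>2 / m)"
  have u0: "u x \<ge> 0" for x using m by (simp add: u_def)
  have "continuous_on UNIV u"
    unfolding u_def using m by (intro continuous_intros continuous_on_norm_matrix_vector_mult) auto
  then have [measurable]: "u \<in> borel_measurable borel" by (rule borel_measurable_continuous_onI)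
  have "(\<integral>\<^sup>+x. ennreal (max 0 (1 - u x)) \<partial>lborel)
      = (\<integral>\<^sup>+x. \<integral>\<^sup>+t. (if 0 \<le> t \<and> t < 1 - u x then 1 else 0) \<partial>(lborel :: real measure) \<partial>lborel)"
  proof (rule nn_integral_cong)
    fix x
    have "(\<integral>\<^sup>+t. (if 0 \<le> t \<and> t < 1 - u x then 1 else 0) \<partial>lborel)
        = (\<integral>\<^sup>+t. indicator {0..<max 0 (1 - u x)} t \<partial>(lborel :: real measure))"
      by (intro nn_integral_cong) (auto simp: indicator_def)
    also have "\<dots> = ennreal (max 0 (1 - u x))" by simp
    finally show "ennreal (max 0 (1 - u x)) = (\<integral>\<^sup>+t. (if 0 \<le> t \<and> t < 1 - u x then 1 else 0) \<partial>lborel)" ..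
  qed
  also have "\<dots> = (\<integral>\<^sup>+t. \<integral>\<^sup>+x. (if 0 \<le> t \<and> t < 1 - u x then 1 else 0) \<partial>lborel \<partial>(lborel :: real measure))"
    by (rule lborel_pair.Fubini') measurable
  also have "\<dots> = (\<integral>\<^sup>+t. ennreal ((pi * m / 2) ^ h / (fact h * \<bar>det B\<bar>) * (1 - t) ^ h) * indicator {0..1} t \<partial>lborel)"
  proof (rule nn_integral_cong)
    fix t :: real
    show "(\<integral>\<^sup>+x. (if 0 \<le> t \<and> t < 1 - u x then 1 else 0) \<partial>lborel)
        = ennreal ((pi * m / 2) ^ h / (fact h * \<bar>det B\<bar>) * (1 - t) ^ h) * indicator {0..1} t"
    proof (cases "0 \<le> t \<and> t \<le> 1")
      case False
      then have "(if 0 \<le> t \<and> t < 1 - u x then 1 else 0 :: ennreal) = 0" for x using u0[of x] by auto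
      then show ?thesis using False by (simp only: nn_integral_const) simp
    next
      case True
      define r where "r = sqrt ((1 - t) * m / 2)"
      have "(1 - t) * m / 2 \<ge> 0" using True m by simp
      then have r: "r \<ge> 0" "r\<^sup>2 = (1 - t) * m / 2" by (auto simp: r_def)
      have "t < 1 - u x \<longleftrightarrow> norm (B *v x) < r" for x
      proof -
        have "t < 1 - u x \<longleftrightarrow> (norm (B *v x))\<^sup>2 < r\<^sup>2"
          unfolding r using m by (simp add: u_def field_simps)
        also have "\<dots> \<longleftrightarrow> norm (B *v x) < r"
          using r(1) by (metis norm_ge_zero power2_less_imp_less power_strict_mono zero_less_numeral)
        finally show ?thesis .
      qed
      then have "(\<integral>\<^sup>+x. (if 0 \<le> t \<and> t < 1 - u x then 1 else 0) \<partial>lborel)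
          = (\<integral>\<^sup>+x. indicator {x. norm (B *v x) < r} x \<partial>lborel)"
        using True by (intro nn_integral_cong) (auto simp: indicator_def)
      also have "\<dots> = emeasure lborel {x. norm (B *v x) < r}"
      proof (rule nn_integral_indicator)
        have "open {x. norm (B *v x) < r}"
          by (intro open_Collect_less continuous_on_norm_matrix_vector_mult continuous_on_const)
        then show "{x. norm (B *v x) < r} \<in> sets lborel" by simp
      qed
      also have "\<dots> = ennreal (unit_ball_vol (real (2 * h)) * r ^ (2 * h) / \<bar>det B\<bar>)"
        using emeasure_ellipsoid[OF assms(1) r(1)] h by simp
      also have "unit_ball_vol (real (2 * h)) * r ^ (2 * h) / \<bar>det B\<bar>
          = (pi * m / 2) ^ h / (fact h * \<bar>det B\<bar>) * (1 - t) ^ h"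
        unfolding unit_ball_vol_even power_mult r by (simp add: power_mult_distrib power_divide mult_ac)
      finally show ?thesis using True by simp
    qed
  qed
  \<comment> \<open>The right-hand side is F 1 - F 0 for the antiderivative F given next, with F 1 = 0.\<close>
  also have "\<dots> = ennreal (0 - (- ((pi * m / 2) ^ h / (fact (h + 1) * \<bar>det B\<bar>))))"
  proof (subst nn_integral_FTC_Icc[where F = "\<lambda>t. - ((pi * m / 2) ^ h / (fact (h + 1) * \<bar>det B\<bar>)) * (1 - t) ^ (h + 1)"])
    fix t :: real
    show "((\<lambda>t. - ((pi * m / 2) ^ h / (fact (h + 1) * \<bar>det B\<bar>)) * (1 - t) ^ (h + 1)) has_real_derivative
         (pi * m / 2) ^ h / (fact h * \<bar>det B\<bar>) * (1 - t) ^ h) (at t)"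
      by (rule derivative_eq_intros refl | simp)+
  qed (use m in auto)
  finally show ?thesis by (simp add: u_def)
qed

section \<open>Blichfeldt's bound for the integer lattice\<close>

text \<open>
  Put the weight \<open>max 0 (1 - 2 \<bar>B (x - z)\<bar>\<^sup>2 / m)\<close> around every integer point \<open>z\<close>. At every \<open>x\<close> the
  weights add up to at most 1, so the integral of a single weight, which is known exactly, is at most
  the volume 1 of the unit cube. For \<open>A = transpose B ** B\<close> the factor \<open>\<bar>det B\<bar>\<close> is \<open>sqrt (det A)\<close>.
\<close>

lemma blichfeldt_bound:
  fixes B :: "real^'n::{finite,wellorder}^'n::{finite,wellorder}" and m :: real
  assumes "det B \<noteq> 0" and m: "m > 0" and h: "CARD('n) = 2 * h"
    and min: "\<And>z. z \<noteq> 0 \<Longrightarrow> (\<And>i. z $ i \<in> \<int>) \<Longrightarrow> m \<le> (norm (B *v z))\<^sup>2"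
  shows "(pi * m / 2) ^ h \<le> fact (h + 1) * \<bar>det B\<bar>"
proof -
  have "continuous_on UNIV (\<lambda>x. max 0 (1 - 2 * (norm (B *v x))\<^sup>2 / m))"
    using m by (intro continuous_intros continuous_on_norm_matrix_vector_mult) auto
  then have meas: "(\<lambda>x. max 0 (1 - 2 * (norm (B *v x))\<^sup>2 / m)) \<in> borel_measurable borel"
    by (rule borel_measurable_continuous_onI)
  have "(\<integral>\<^sup>+x. ennreal (max 0 (1 - 2 * (norm (B *v x))\<^sup>2 / m)) \<partial>lborel) \<le> 1"
  proof (rule nn_integral_le_1_if_lattice_sums_le_1)
    show "(\<lambda>x. ennreal (max 0 (1 - 2 * (norm (B *v x))\<^sup>2 / m))) \<in> borel_measurable borel"
      using meas by simp
    fix x :: "real^'n::{finite,wellorder}" and Z :: "(real^'n::{finite,wellorder}) set"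
    assume Z: "finite Z" "Z \<subseteq> {z. \<forall>i. z $ i \<in> \<int>}"
    have "(\<Sum>z\<in>Z. max 0 (1 - 2 * (norm (B *v (x + z)))\<^sup>2 / m)) \<le> 1"
    proof (rule sum_packing_weights_le_1[OF Z(1) m])
      fix z w assume zw: "z \<in> Z" "w \<in> Z" "z \<noteq> w"
      have "B *v (x + z) - B *v (x + w) = B *v (z - w)"
        by (simp add: matrix_vector_mult_diff_distrib matrix_vector_right_distrib)
      then show "m \<le> (norm (B *v (x + z) - B *v (x + w)))\<^sup>2"
        using min[of "z - w"] zw Z(2) by (auto intro: Ints_diff)
    qed
    then show "(\<Sum>z\<in>Z. ennreal (max 0 (1 - 2 * (norm (B *v (x + z)))\<^sup>2 / m))) \<le> 1"
      by (subst sum_ennreal) (auto simp flip: ennreal_1)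
  qed
  then have "(pi * m / 2) ^ h / (fact (h + 1) * \<bar>det B\<bar>) \<le> 1"
    unfolding nn_integral_ellipsoid_weight[OF assms(1) m h] by simp
  moreover have D: "fact (h + 1) * \<bar>det B\<bar> > 0" using assms(1) by simp
  ultimately show ?thesis by (simp only: divide_le_eq_1_pos[OF D])
qed

section \<open>Positive definite matrices\<close>

lemma inner_symmetric_matrix:
  fixes A :: "real^'n^'n"
  assumes "transpose A = A"
  shows "x \<bullet> (A *v y) = y \<bullet> (A *v x)"
  by (metis assms dot_lmul_matrix inner_commute transpose_matrix_vector)

text \<open>
  A minimum of the quadratic form on the unit sphere is attained at an eigenvector, and the minimum
  value \<open>c\<close> is the eigenvalue: the form \<open>x \<mapsto> quad_form A x - c \<bar>x\<bar>\<^sup>2\<close> is nonnegative and vanishes at the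
  minimiser \<open>u\<close>, so its gradient, which is twice \<open>w = A u - c u\<close>, vanishes there.
\<close>

lemma quad_form_pos_if_eigenvalues_pos:
  fixes A :: "real^'n^'n"
  assumes sym: "transpose A = A" and ev: "\<And>c. eigenvalue A c \<Longrightarrow> c > 0" and "x \<noteq> 0"
  shows "quad_form A x > 0"
proof -
  let ?S = "sphere (0::real^'n) 1"
  have lin: "linear ((*v) A)" by simp
  have "continuous_on ?S (quad_form A)"
    unfolding quad_form_def
    by (intro continuous_intros linear_continuous_on linear_conv_bounded_linear[THEN iffD1] lin)
  moreover have "?S \<noteq> {}" by simp
  ultimately obtain u where u: "norm u = 1" and umin: "\<And>y. norm y = 1 \<Longrightarrow> quad_form A u \<le> quad_form A y"
    using continuous_attains_inf[of ?S "quad_form A"] by auto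
  define c where "c = quad_form A u"
  have min: "c * (norm y)\<^sup>2 \<le> quad_form A y" for y
  proof (cases "y = 0")
    case False
    have "c \<le> quad_form A (y /\<^sub>R norm y)" unfolding c_def by (rule umin) (use False in simp)
    also have "\<dots> = quad_form A y / (norm y)\<^sup>2"
      by (simp add: quad_form_def matrix_vector_mult_scaleR power2_eq_square field_simps)
    finally show ?thesis using False by (simp add: field_simps)
  qed (simp add: quad_form_def)
  define w where "w = A *v u - c *\<^sub>R u"
  have "w \<bullet> w = 0"
  proof (rule ccontr)
    assume "w \<bullet> w \<noteq> 0"
    then have w: "w \<bullet> w > 0" by (simp add: inner_gt_zero_iff)
    define D where "D = quad_form A w - c * (w \<bullet> w)"
    have ineq: "0 \<le> 2 * t * (w \<bullet> w) + t\<^sup>2 * D" for t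
    proof -
      have "0 \<le> quad_form A (u + t *\<^sub>R w) - c * (norm (u + t *\<^sub>R w))\<^sup>2" using min by simp
      also have "\<dots> = (quad_form A u - c * (u \<bullet> u)) + 2 * t * (w \<bullet> (A *v u - c *\<^sub>R u)) + t\<^sup>2 * D"
        using inner_symmetric_matrix[OF sym, of u w]
        by (simp add: quad_form_def D_def power2_norm_eq_inner matrix_vector_right_distrib
            matrix_vector_mult_scaleR inner_simps inner_commute algebra_simps power2_eq_square[of t])
      also have "quad_form A u - c * (u \<bullet> u) = 0"
        using u by (simp add: c_def norm_eq_1)
      finally show ?thesis by (simp add: w_def)
    qed
    have D: "D \<ge> 0" unfolding D_def using min[of w] by (simp add: power2_norm_eq_inner)
    \<comment> \<open>A step from u against the gradient w, so short that the quadratic term cannot compensate.\<close>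
    define t where "t = - (w \<bullet> w) / (D + 1)"
    have "2 * t * (w \<bullet> w) + t\<^sup>2 * D < 0"
    proof -
      have "t < 0" using w D by (simp add: t_def)
      moreover have "2 * (w \<bullet> w) + t * D > 0"
      proof -
        have "t * (D + 1) = - (w \<bullet> w)" using D by (simp add: t_def)
        then have "t * D = - (w \<bullet> w) - t" by (simp add: algebra_simps)
        then show ?thesis using w \<open>t < 0\<close> by linarith
      qed
      ultimately have "t * (2 * (w \<bullet> w) + t * D) < 0" by (rule mult_neg_pos)
      then show ?thesis by (simp add: algebra_simps power2_eq_square)
    qed
    then show False using ineq[of t] by simp
  qed
  then have "A *v u = c *s u" by (simp add: w_def scalar_mult_eq_scaleR)
  moreover have "u \<noteq> 0" using u by auto
  ultimately have "c > 0" using ev unfolding eigenvalue_def by blast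
  then have "0 < c * (norm x)\<^sup>2" using assms(3) by simp
  then show ?thesis using min[of x] by simp
qed

text \<open>
  Gram-Schmidt for the inner product \<open>x \<bullet> (A *v y)\<close> gives a basis, the columns of a matrix \<open>C\<close>, with
  \<open>transpose C ** A ** C = mat 1\<close>; then \<open>B\<close> is the inverse of \<open>C\<close> and \<open>A = transpose B ** B\<close>.
\<close>

lemma pos_def_matrix_factorization:
  fixes A :: "real^'n^'n"
  assumes sym: "transpose A = A" and pos: "\<And>x. x \<noteq> 0 \<Longrightarrow> quad_form A x > 0"
  obtains B where "\<And>x. quad_form A x = (norm (B *v x))\<^sup>2" and "det A = (det B)\<^sup>2" and "det B \<noteq> 0"
proof -
  have "\<exists>e. \<forall>i\<in>S. \<forall>j\<in>S. e i \<bullet> (A *v e j) = (if i = j then 1 else 0)" if "finite S" for S :: "'n set"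
    using that
  proof (induction S)
    case (insert k S)
    then obtain e where e: "\<And>i j. i \<in> S \<Longrightarrow> j \<in> S \<Longrightarrow> e i \<bullet> (A *v e j) = (if i = j then 1 else 0)" by blast
    \<comment> \<open>Fewer than CARD('n) linear conditions have a common nonzero solution; it is the next basis vector.\<close>
    have "dim ((\<lambda>i. A *v e i) ` S) \<le> card ((\<lambda>i. A *v e i) ` S)"
      using insert.hyps by (intro dim_le_card') simp
    also have "\<dots> \<le> card S" using insert.hyps by (intro card_image_le)
    also have "\<dots> < CARD('n)" using insert.hyps by (intro psubset_card_mono) auto
    finally obtain x where x: "x \<noteq> 0" "\<And>y. y \<in> span ((\<lambda>i. A *v e i) ` S) \<Longrightarrow> orthogonal x y"
      by (metis DIM_cart DIM_real mult.right_neutral orthogonal_to_subspace_exists)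
    then have orth: "x \<bullet> (A *v e i) = 0" if "i \<in> S" for i
      using that by (auto simp: orthogonal_def intro: span_base)
    then have orth': "e i \<bullet> (A *v x) = 0" if "i \<in> S" for i
      using that inner_symmetric_matrix[OF sym, of x "e i"] by simp
    define e' where "e' = e(k := x /\<^sub>R sqrt (quad_form A x))"
    have qx: "quad_form A x > 0" using pos x by blast
    have "x \<bullet> (A *v x) / (sqrt (quad_form A x) * sqrt (quad_form A x)) = 1"
      using qx by (simp add: quad_form_def)
    then have "e' i \<bullet> (A *v e' j) = (if i = j then 1 else 0)" if "i \<in> insert k S" "j \<in> insert k S" for i j
      using that insert.hyps e orth orth'
      by (auto simp: e'_def matrix_vector_mult_scaleR field_simps)
    then show ?case by blast
  qed simp
  from this[of UNIV] obtain e where e: "\<And>i j :: 'n. e i \<bullet> (A *v e j) = (if i = j then 1 else 0)" by auto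
  define C :: "real^'n^'n" where "C = (\<chi> i j. e j $ i)"
  have "transpose C ** A ** C = mat 1"
  proof -
    have "(transpose C ** (A ** C)) $ i $ j = e i \<bullet> (A *v e j)" for i j
      by (simp add: matrix_matrix_mult_def matrix_vector_mult_def transpose_def C_def inner_vec_def)
    then show ?thesis by (simp add: vec_eq_iff e mat_def matrix_mul_assoc)
  qed
  moreover from this have "det C * det A * det C = 1" by (metis det_mul det_I det_transpose)
  then have "det C \<noteq> 0" by auto
  then obtain B where B: "B ** C = mat 1" "C ** B = mat 1"
    unfolding invertible_det_nz[symmetric] invertible_def by blast
  have BT: "transpose B ** transpose C = mat 1"
    using B(2) by (metis matrix_transpose_mul transpose_mat)
  have A: "A = transpose B ** B"
  proof -
    have "transpose B ** (transpose C ** A ** C) ** B = (transpose B ** transpose C) ** A ** (C ** B)"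
      by (simp add: matrix_mul_assoc)
    then show ?thesis using calculation by (simp add: BT B)
  qed
  show ?thesis
  proof
    show "quad_form A x = (norm (B *v x))\<^sup>2" for x
      unfolding quad_form_def A power2_norm_eq_inner matrix_vector_mul_assoc[symmetric]
      by (metis dot_lmul_matrix inner_commute transpose_matrix_vector transpose_transpose)
    show "det A = (det B)\<^sup>2" by (simp add: A det_mul power2_eq_square)
    have "det B * det C = 1" using B by (metis det_mul det_I)
    then show "det B \<noteq> 0" by auto
  qed
qed

section \<open>Integrality\<close>

lemma det_in_Ints:
  fixes M :: "real^'n^'n"
  assumes "\<And>i j. M $ i $ j \<in> \<int>"
  shows "det M \<in> \<int>"
  unfolding det_def using assms by (intro Ints_sum Ints_mult Ints_prod) auto

text \<open>
  The diagonal entries are even, and each pair of off-diagonal terms contributes twice the same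
  integer. The induction runs over the index set of a principal submatrix.
\<close>

lemma quad_form_even:
  fixes A :: "real^'n^'n"
  assumes sym: "transpose A = A" and ev: "even_integral A" and x: "\<And>i. x $ i \<in> \<int>"
  shows "\<exists>k::int. quad_form A x = 2 * of_int k"
proof -
  have s: "A $ i $ j = A $ j $ i" for i j using sym by (metis transpose_def vec_lambda_beta)
  have "\<exists>k::int. (\<Sum>i\<in>S. \<Sum>j\<in>S. x $ i * (A $ i $ j * x $ j)) = 2 * of_int k" if "finite S" for S
    using that
  proof (induction S)
    case (insert a S)
    then obtain k :: int where k: "(\<Sum>i\<in>S. \<Sum>j\<in>S. x $ i * (A $ i $ j * x $ j)) = 2 * of_int k" by blast
    obtain l :: int where l: "A $ a $ a = 2 * of_int l" using ev unfolding even_integral_def by blast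
    obtain y :: int where y: "x $ a = of_int y" using x Ints_cases by blast
    have "(\<Sum>i\<in>S. x $ i * (A $ i $ a * x $ a)) \<in> \<int>"
      using ev x by (intro Ints_sum Ints_mult) (auto simp: even_integral_def)
    then obtain c :: int where c: "(\<Sum>i\<in>S. x $ i * (A $ i $ a * x $ a)) = of_int c" using Ints_cases by blast
    have c': "(\<Sum>j\<in>S. x $ a * (A $ a $ j * x $ j)) = of_int c"
      unfolding c[symmetric] by (intro sum.cong) (auto simp: s[of a])
    have "(\<Sum>i\<in>insert a S. \<Sum>j\<in>insert a S. x $ i * (A $ i $ j * x $ j)) =
       x $ a * (A $ a $ a * x $ a) + of_int c + (of_int c + 2 * of_int k)"
      using insert.hyps c c' k by (simp add: sum.distrib)
    also have "\<dots> = 2 * of_int (y * l * y + c + k)" using l y by simp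
    finally show ?case by blast
  qed simp
  from this[of UNIV] show ?thesis
    by (simp add: quad_form_def inner_vec_def matrix_vector_mult_def sum_distrib_left)
qed

text \<open>
  By Cramer's rule these numbers are the cofactors of \<open>A\<close>.
\<close>

lemma det_times_inverse_in_Ints:
  fixes A M :: "real^'n^'n"
  assumes int: "\<And>i j. A $ i $ j \<in> \<int>" and inv: "A ** M = mat 1"
  shows "det A * M $ i $ j \<in> \<int>"
proof -
  have "det A * det M = 1" using inv by (metis det_mul det_I)
  then have "det A \<noteq> 0" by auto
  have "A *v (M *v axis j 1) = axis j 1" by (simp add: matrix_vector_mul_assoc inv)
  then have "M *v axis j 1 = (\<chi> k. det (\<chi> i l. if l = k then axis j 1 $ i else A $ i $ l) / det A)"
    using cramer[OF \<open>det A \<noteq> 0\<close>] by blast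
  then have "(M *v axis j 1) $ i = det (\<chi> i' l. if l = i then axis j 1 $ i' else A $ i' $ l) / det A"
    by simp
  moreover have "(M *v axis j 1) $ i = M $ i $ j"
    by (simp add: matrix_vector_mult_def axis_def if_distrib cong: if_cong)
  ultimately have "det A * M $ i $ j = det (\<chi> i' l. if l = i then axis j 1 $ i' else A $ i' $ l)"
    using \<open>det A \<noteq> 0\<close> by simp
  also have "\<dots> \<in> \<int>" by (intro det_in_Ints) (auto simp: int axis_def)
  finally show ?thesis .
qed

text \<open>
  The level is defined as a least number, so that its defining property needs a witness:
  \<open>2 * det A\<close> is one.
\<close>

lemma level_scaled_inverse_even_integral:
  fixes A :: "real^'n^'n"
  assumes int: "\<And>i j. A $ i $ j \<in> \<int>" and d: "det A > 0"
  shows "even_integral (real (level A) *\<^sub>R matrix_inv A)" and "A ** matrix_inv A = mat 1"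
proof -
  have "invertible A" using d by (simp add: invertible_det_nz)
  then show inv: "A ** matrix_inv A = mat 1"
    unfolding invertible_def matrix_inv_def by (metis (mono_tags, lifting) someI_ex)
  obtain D :: int where D: "det A = of_int D" using det_in_Ints[OF int] Ints_cases by blast
  have "D > 0" using d D by simp
  define N where "N = nat (2 * D)"
  have N: "real N = 2 * det A" using \<open>D > 0\<close> D by (simp add: N_def)
  have "even_integral (real N *\<^sub>R matrix_inv A)"
    using det_times_inverse_in_Ints[OF int inv]
    by (auto simp: even_integral_def N mult.assoc Ints_mult) (metis Ints_cases)
  moreover have "N > 0" using \<open>D > 0\<close> by (simp add: N_def)
  ultimately have "N > 0 \<and> even_integral (real N *\<^sub>R matrix_inv A)" by blast
  from LeastI[of "\<lambda>N. N > 0 \<and> even_integral (real N *\<^sub>R matrix_inv A)", OF this]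
  show "even_integral (real (level A) *\<^sub>R matrix_inv A)" by (simp add: level_def)
qed

section \<open>Comparing a factorial with a power\<close>

text \<open>
  Asymptotically the left side grows like \<open>(h / e)\<^sup>h\<close> up to a power of \<open>h\<close>, and \<open>\<pi> / 8 > 1 / e\<close>. For a
  proof by induction, the quotient of consecutive right sides must be at least \<open>h + 2\<close>. Since
  \<open>(h + 9) / (h + 8) \<ge> exp (1 / (h + 9))\<close> and \<open>exp (- 9 / (h + 9)) \<ge> h / (h + 9)\<close>, that quotient is at
  least \<open>(\<pi> e / 8) h\<close>, which suffices from \<open>h = 30\<close> on; below that the inequality is computed.
\<close>

lemma fact_less_power:
  assumes "1 \<le> h"
  shows "fact (h + 1) < (pi * (real h + 8) / 8) ^ h"
proof -
  \<comment> \<open>A rational lower bound of pi / 8, since 3.14 / 8 = 157 / 400.\<close>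
  define c :: real where "c = 157 / 400"
  have small: "fact (h + 1) < (c * (real h + 8)) ^ h" if "1 \<le> h" "h \<le> 30" for h
  proof -
    have "\<forall>k \<in> set [1..<31]. fact (k + 1) < (c * (real k + 8)) ^ k"
      by (simp add: c_def upt_rec[of 1] upt_rec_numeral fact_numeral power_divide power_mult_distrib del: set_upt One_nat_def)
    moreover have "h \<in> set [1..<31]" using that by simp
    ultimately show ?thesis by blast
  qed
  have ratio: "real h + 2 \<le> c * (real h + 9) * ((real h + 9) / (real h + 8)) ^ h" if "30 \<le> h" for h :: nat
  proof -
    define y where "y = 1 / (real h + 9)"
    have e1: "exp y \<le> (real h + 9) / (real h + 8)"
    proof -
      have "exp y * (1 + - y) \<le> exp y * exp (- y)"
        by (intro mult_left_mono exp_ge_add_one_self) simp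
      also have "\<dots> = 1" by (simp add: exp_minus)
      finally have "exp y * (1 + - y) \<le> 1" .
      moreover have "1 + - y = (real h + 8) / (real h + 9)" by (simp add: y_def field_simps)
      ultimately have "exp y * ((real h + 8) / (real h + 9)) \<le> 1" by metis
      then show ?thesis by (simp add: field_simps)
    qed
    have "exp 1 * (real h / (real h + 9)) \<le> exp 1 * exp (- 9 * y)"
      using exp_ge_add_one_self[of "- 9 * y"] by (intro mult_left_mono) (auto simp: y_def field_simps)
    also have "\<dots> = exp (real h * y)" by (simp add: y_def exp_add[symmetric] field_simps)
    also have "\<dots> = exp y ^ h" by (simp add: exp_of_nat_mult)
    also have "\<dots> \<le> ((real h + 9) / (real h + 8)) ^ h" using e1 by (intro power_mono) auto
    finally have e2: "exp 1 * (real h / (real h + 9)) \<le> ((real h + 9) / (real h + 8)) ^ h" .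
    have "exp 1 \<ge> (2718 / 1000 :: real)" using e_approx_32 by (simp add: abs_if split: if_splits)
    then have "c * (2718 / 1000) * real h \<le> c * exp 1 * real h" by (intro mult_right_mono) (auto simp: c_def)
    moreover have "real h + 2 \<le> c * (2718 / 1000) * real h" using that by (simp add: c_def)
    ultimately have "real h + 2 \<le> c * exp 1 * real h" by linarith
    also have "\<dots> = c * (real h + 9) * (exp 1 * (real h / (real h + 9)))" by simp
    also have "\<dots> \<le> c * (real h + 9) * ((real h + 9) / (real h + 8)) ^ h"
      using e2 by (intro mult_left_mono) (auto simp: c_def)
    finally show ?thesis .
  qed
  have "fact (h + 1) < (c * (real h + 8)) ^ h"
  proof (cases "h \<le> 30")
    case False
    then have "30 \<le> h" by simp
    then show ?thesis
    proof (induction h rule: dec_induct)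
      case (step k)
      have "fact (Suc k + 1) = (real k + 2) * fact (k + 1)" by simp
      also have "\<dots> < (real k + 2) * (c * (real k + 8)) ^ k" using step.IH by simp
      also have "\<dots> \<le> (c * (real k + 9) * ((real k + 9) / (real k + 8)) ^ k) * (c * (real k + 8)) ^ k"
        using \<open>30 \<le> k\<close> by (intro mult_right_mono ratio) (auto simp: c_def)
      also have "\<dots> = (c * (real (Suc k) + 8)) ^ Suc k"
        by (simp add: power_mult_distrib power_divide add.commute)
      finally show ?case .
    next
      case base
      show ?case by (rule small) simp_all
    qed
  qed (use small assms in simp)
  also have "\<dots> \<le> (pi * (real h + 8) / 8) ^ h"
  proof (rule power_mono)
    have "c \<le> pi / 8" using pi_approx(1) by (simp add: c_def)
    then have "c * (real h + 8) \<le> pi / 8 * (real h + 8)" by (rule mult_right_mono) simp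
    then show "c * (real h + 8) \<le> pi * (real h + 8) / 8" by simp
  qed (simp add: c_def)
  finally show ?thesis .
qed

section \<open>Short vectors when twice the inverse matrix is integral\<close>

text \<open>
  Taking determinants, \<open>det A * det M = 2\<^sup>2\<^sup>h\<close> with a positive integer \<open>det M\<close>, so \<open>det A \<le> 2\<^sup>2\<^sup>h\<close> and
  \<open>\<bar>det B\<bar> \<le> 2\<^sup>h\<close> for a factorization \<open>A = transpose B ** B\<close>. If no short vector existed,
  Blichfeldt's bound with \<open>m = 4 + h / 2\<close> would give \<open>(\<pi> (h + 8) / 8)\<^sup>h \<le> (h + 1)!\<close>.
\<close>

lemma short_vector_wellordered_index:
  fixes A M :: "real^'n::{finite,wellorder}^'n::{finite,wellorder}"
  assumes sym: "transpose A = A" and pos: "\<And>x. x \<noteq> 0 \<Longrightarrow> quad_form A x > 0"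
    and int: "\<And>i j. M $ i $ j \<in> \<int>" and inv: "A ** M = 2 *\<^sub>R mat 1"
    and h: "CARD('n) = 2 * h"
  shows "\<exists>z. z \<noteq> 0 \<and> (\<forall>i. z $ i \<in> \<int>) \<and> quad_form A z < 4 + real h / 2"
proof (rule ccontr)
  assume neg: "\<not> ?thesis"
  obtain B where B: "\<And>x. quad_form A x = (norm (B *v x))\<^sup>2" "det A = (det B)\<^sup>2" "det B \<noteq> 0"
    using pos_def_matrix_factorization[OF sym pos] by blast
  have "det A * det M = det (2 *\<^sub>R mat 1 :: real^'n::{finite,wellorder}^'n::{finite,wellorder})" by (metis inv det_mul)
  also have "\<dots> = 2 ^ (2 * h)" by (subst det_diagonal) (auto simp: mat_def h)
  finally have prod: "det A * det M = 2 ^ (2 * h)" .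
  have detA: "det A > 0" using B by simp
  then have "det M > 0" using prod by (metis zero_less_mult_pos zero_less_numeral zero_less_power)
  moreover have "det M \<in> \<int>" by (intro det_in_Ints int)
  ultimately have "det M \<ge> 1" by (auto elim!: Ints_cases)
  then have "det A * 1 \<le> det A * det M" using detA by (intro mult_left_mono) auto
  then have "(det B)\<^sup>2 \<le> (2 ^ h)\<^sup>2" unfolding prod by (simp only: B(2) mult_1_right power_even_eq)
  then have detB: "\<bar>det B\<bar> \<le> 2 ^ h" using abs_le_square_iff[of "det B" "2 ^ h"] by simp
  have "(pi * (4 + real h / 2) / 2) ^ h \<le> fact (h + 1) * \<bar>det B\<bar>"
  proof (rule blichfeldt_bound[OF B(3) _ h])
    fix z :: "real^'n::{finite,wellorder}" assume "z \<noteq> 0" "\<And>i. z $ i \<in> \<int>"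
    then show "4 + real h / 2 \<le> (norm (B *v z))\<^sup>2" using neg B(1) by (metis not_less)
  qed simp
  also have "\<dots> \<le> fact (h + 1) * 2 ^ h" using detB by (intro mult_left_mono) auto
  also have "pi * (4 + real h / 2) / 2 = pi * (real h + 8) / 8 * 2" by simp
  finally have "(pi * (real h + 8) / 8) ^ h * 2 ^ h \<le> fact (h + 1) * 2 ^ h"
    unfolding power_mult_distrib[of _ "2::real"] .
  then have "(pi * (real h + 8) / 8) ^ h \<le> fact (h + 1)"
    by (rule mult_right_le_imp_le) simp
  moreover have "1 \<le> h" using h zero_less_card_finite[where 'a = 'n] by linarith
  ultimately show False using fact_less_power[of h] by simp
qed

text \<open>
  A copy of a finite type that carries a well-order, obtained by numbering the elements. Renaming the
  coordinates along it frees the preceding lemma from the order on the index type.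
\<close>

typedef 'a ordered_index = "UNIV :: 'a set" by simp

lemma bij_Rep_ordered_index: "bij Rep_ordered_index"
proof (rule bijI)
  show "inj Rep_ordered_index" by (simp add: inj_def Rep_ordered_index_inject)
  show "surj Rep_ordered_index"
    by (rule surjI[of _ Abs_ordered_index]) (simp add: Abs_ordered_index_inverse)
qed

instance ordered_index :: (finite) finite
proof
  show "finite (UNIV :: 'a ordered_index set)"
    by (simp add: bij_betw_finite[OF bij_Rep_ordered_index])
qed

instantiation ordered_index :: (finite) wellorder
begin

definition less_eq_ordered_index :: "'a ordered_index \<Rightarrow> 'a ordered_index \<Rightarrow> bool" where
  "x \<le> y \<longleftrightarrow> to_nat (Rep_ordered_index x) \<le> to_nat (Rep_ordered_index y)"

definition less_ordered_index :: "'a ordered_index \<Rightarrow> 'a ordered_index \<Rightarrow> bool" where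
  "x < y \<longleftrightarrow> to_nat (Rep_ordered_index x) < to_nat (Rep_ordered_index y)"

instance
proof
  fix P :: "'a ordered_index \<Rightarrow> bool" and a :: "'a ordered_index"
  assume step: "\<And>x. (\<And>y. y < x \<Longrightarrow> P y) \<Longrightarrow> P x"
  show "P a"
    by (induction "to_nat (Rep_ordered_index a)" arbitrary: a rule: less_induct)
      (use step in \<open>auto simp: less_ordered_index_def\<close>)
qed (auto simp: less_eq_ordered_index_def less_ordered_index_def Rep_ordered_index_inject)

end

lemma short_vector_of_inverse_integral:
  fixes A M :: "real^'n^'n"
  assumes sym: "transpose A = A" and pos: "\<And>x. x \<noteq> 0 \<Longrightarrow> quad_form A x > 0"
    and int: "\<And>i j. M $ i $ j \<in> \<int>" and inv: "A ** M = 2 *\<^sub>R mat 1"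
    and h: "CARD('n) = 2 * h"
  shows "\<exists>z. z \<noteq> 0 \<and> (\<forall>i. z $ i \<in> \<int>) \<and> quad_form A z < 4 + real h / 2"
proof -
  let ?r = "Rep_ordered_index :: 'n ordered_index \<Rightarrow> 'n"
  let ?a = "Abs_ordered_index :: 'n \<Rightarrow> 'n ordered_index"
  have ar: "?a (?r i) = i" for i by (rule Rep_ordered_index_inverse)
  have sum_r: "(\<Sum>i\<in>UNIV. f (?r i)) = (\<Sum>i\<in>UNIV. f i)" for f :: "'n \<Rightarrow> real"
    by (rule sum.reindex_bij_betw) (rule bij_Rep_ordered_index)
  define re :: "real^'n^'n \<Rightarrow> real^'n ordered_index^'n ordered_index"
    where "re = (\<lambda>X. \<chi> i j. X $ ?r i $ ?r j)"
  define vec_of :: "real^'n ordered_index \<Rightarrow> real^'n" where "vec_of = (\<lambda>z. \<chi> i. z $ ?a i)"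
  have q: "quad_form (re A) z = quad_form A (vec_of z)" for z
  proof -
    have "quad_form (re A) z = (\<Sum>i\<in>UNIV. vec_of z $ ?r i * (\<Sum>j\<in>UNIV. A $ ?r i $ ?r j * vec_of z $ ?r j))"
      by (simp add: quad_form_def inner_vec_def matrix_vector_mult_def re_def vec_of_def ar)
    also have "\<dots> = quad_form A (vec_of z)"
      by (simp add: sum_r[of "\<lambda>j. A $ _ $ j * vec_of z $ j"]
          sum_r[of "\<lambda>i. vec_of z $ i * (\<Sum>j\<in>UNIV. A $ i $ j * vec_of z $ j)"]
          quad_form_def inner_vec_def matrix_vector_mult_def)
    finally show ?thesis .
  qed
  have nz: "vec_of z \<noteq> 0" if "z \<noteq> 0" for z
    using that ar by (auto simp: vec_of_def vec_eq_iff) metis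
  have "\<exists>z. z \<noteq> 0 \<and> (\<forall>i. z $ i \<in> \<int>) \<and> quad_form (re A) z < 4 + real h / 2"
  proof (rule short_vector_wellordered_index)
    have "A $ i $ j = A $ j $ i" for i j using sym by (metis transpose_def vec_lambda_beta)
    then show "transpose (re A) = re A" by (simp add: transpose_def re_def vec_eq_iff)
    show "quad_form (re A) z > 0" if "z \<noteq> 0" for z using pos nz that by (simp add: q)
    show "re M $ i $ j \<in> \<int>" for i j by (simp add: re_def int)
    have "(re A ** re M) $ i $ j = (A ** M) $ ?r i $ ?r j" for i j
      using sum_r[of "\<lambda>k. A $ ?r i $ k * M $ k $ ?r j"] by (simp add: matrix_matrix_mult_def re_def)
    then show "re A ** re M = 2 *\<^sub>R mat 1"
      by (simp add: vec_eq_iff inv mat_def Rep_ordered_index_inject)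
    show "CARD('n ordered_index) = 2 * h"
      using bij_betw_same_card[OF bij_Rep_ordered_index[where 'a = 'n]] h by simp
  qed
  then obtain z where "z \<noteq> 0" "\<And>i. z $ i \<in> \<int>" "quad_form (re A) z < 4 + real h / 2" by blast
  then show ?thesis using nz q by (intro exI[of _ "vec_of z"]) (auto simp: vec_of_def)
qed

section \<open>Forms of level two\<close>

theorem theorem5p1:
  fixes A :: "real^'n^'n"
  assumes "even CARD('n)"
    and "even_pos_def A"
    and "level A = 2"
  shows "(8 dvd CARD('n) \<longrightarrow>
           (\<exists>n::int. 0 < 2 * n \<and> real_of_int (2 * n) \<le> 2 + real CARD('n) / 4 \<and>
              represents (quad_form A) (2 * n))) \<and>
         (CARD('n) mod 8 = 4 \<longrightarrow>
           (\<exists>n::int. 0 < 2 * n \<and> real_of_int (2 * n) \<le> 2 + real CARD('n) / 2 \<and>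
              represents (quad_form A) (2 * n)))"
proof -
  have sym: "transpose A = A" and ev: "even_integral A" and eig: "\<And>c. eigenvalue A c \<Longrightarrow> c > 0"
    using assms(2) unfolding even_pos_def_def by blast+
  have pos: "quad_form A x > 0" if "x \<noteq> 0" for x
    using quad_form_pos_if_eigenvalues_pos[OF sym eig that] .
  have int: "A $ i $ j \<in> \<int>" for i j using ev by (simp add: even_integral_def)
  have det: "det A > 0"
    by (rule pos_def_matrix_factorization[OF sym pos]) auto
  define M where "M = 2 *\<^sub>R matrix_inv A"
  have "even_integral M"
    using level_scaled_inverse_even_integral(1)[OF int det] assms(3) by (simp add: M_def)
  then have "M $ i $ j \<in> \<int>" for i j by (simp add: even_integral_def)
  moreover have "A ** M = 2 *\<^sub>R mat 1"
    using level_scaled_inverse_even_integral(2)[OF int det]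
    by (simp add: M_def matrix_scalar_ac scalar_matrix_assoc[symmetric])
  moreover obtain h where h: "CARD('n) = 2 * h" using assms(1) by (elim evenE)
  ultimately obtain z where z: "z \<noteq> 0" "\<And>i. z $ i \<in> \<int>" "quad_form A z < 4 + real h / 2"
    using short_vector_of_inverse_integral[OF sym pos] by blast
  obtain k :: int where k: "quad_form A z = 2 * of_int k"
    using quad_form_even[OF sym ev z(2)] by blast
  have "k > 0" using pos[OF z(1)] k by simp
  have rep: "represents (quad_form A) (2 * k)"
    unfolding represents_def using z(2) k by (intro exI[of _ z]) simp
  \<comment> \<open>The value 2k is an even integer below 4 + h/2; rounding down gives both claims.\<close>
  have bound: "4 * k < 8 + int h" using z(3) k by linarith
  have le8: "real_of_int (2 * k) \<le> 2 + real CARD('n) / 4" if "8 dvd CARD('n)"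
  proof -
    have "4 dvd h" using that h by presburger
    then obtain w where w: "h = 4 * w" by (elim dvdE)
    then have "k \<le> 1 + int w" using bound by linarith
    then have "real_of_int k \<le> real_of_int (1 + int w)" by (simp only: of_int_le_iff)
    then show ?thesis using h w by simp
  qed
  have le4: "real_of_int (2 * k) \<le> 2 + real CARD('n) / 2" if "CARD('n) mod 8 = 4"
  proof -
    have "h mod 4 = 2" using that unfolding h by presburger
    then have w: "h = 4 * (h div 4) + 2" by presburger
    then have "k \<le> 2 + int (h div 4)" using bound by linarith
    then have "real_of_int k \<le> real_of_int (2 + int (h div 4))" by (simp only: of_int_le_iff)
    moreover have "real h = 4 * real (h div 4) + 2" by (subst w) simp
    moreover have "0 \<le> real (h div 4)" by simp
    ultimately show ?thesis unfolding h of_nat_mult of_nat_numeral by linarith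
  qed
  have "0 < 2 * k" using \<open>k > 0\<close> by simp
  then show ?thesis using rep le8 le4 by blast
qed

end
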